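(* For every graph $G$ and every integer $l \ge 4$, $$FZ(ILAT_l(G)) \ne |V(ILAT_l(G))| - 3.$$
   Context: Graphs are finite, simple, undirected and have at least one vertex. For a vertex $v$ of a graph $G$, $N(v)$ is its neighborhood and $N[v]=N(v)\cup\{v\}$. A new vertex $v'$ added to $G$ is an anticlone of $v\in V(G)$ if $N(v')=V(G)\setminus N[v]$. The ILAT graphs with base graph $G$ are defined by $ILAT_0(G)=G$; $ILAT_1(G)$ is the graph obtained from $G$ by simultaneously adding exactly one anticlone of every vertex of $G$ (the new vertices are pairwise non-adjacent); and $ILAT_l(G)=ILAT_1(ILAT_{l-1}(G))$. Zero forcing on a graph $G$: start with a set $S\subseteq V(G)$ of forced vertices, the remaining vertices being unforced. At each time step, any forced vertex with exactly one unforced neighbor $u$ causes $u$ to become forced. $S$ is a zero forcing set if by iterating this process every vertex eventually becomes forced, and a failed zero forcing set otherwise. $FZ(G)$, the failed zero forcing number, is the maximum cardinality of a failed zero forcing set of $G$. *)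

theory Defs
  imports "Graph_Theory.Pair_Digraph"
begin

text \<open>
  A finite simple undirected graph is an instance of the locale \<open>pair_graph\<close>: its vertex set is
  finite and its arc set is a symmetric, irreflexive relation on the vertices, so that an edge
  \<open>uv\<close> is present as both \<open>(u, v)\<close> and \<open>(v, u)\<close>.
\<close>

definition neighborhood :: "'a pair_pre_digraph \<Rightarrow> 'a \<Rightarrow> 'a set" where
  "neighborhood G v = {w. (v, w) \<in> parcs G}"

definition closed_neighborhood :: "'a pair_pre_digraph \<Rightarrow> 'a \<Rightarrow> 'a set" where
  "closed_neighborhood G v = insert v (neighborhood G v)"


section \<open>ILAT graphs\<close>

text \<open>
  One step of the construction renames every vertex \<open>v\<close> to \<open>Old v\<close> and adds the anticlone
  \<open>New v\<close>, so the added vertices are fresh whatever the graph is. As a consequence \<open>G\<close> sits inside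
  \<open>ILAT1 G\<close>, and inside \<open>ILAT l G\<close>, up to renaming only.
\<close>

datatype 'a ilat_vertex = Base 'a | Old "'a ilat_vertex" | New "'a ilat_vertex"

definition anticlone_arcs :: "'a ilat_vertex pair_pre_digraph \<Rightarrow> 'a ilat_vertex rel" where
  "anticlone_arcs G =
     {(New v, Old w) | v w. v \<in> pverts G \<and> w \<in> pverts G - closed_neighborhood G v}"

definition ILAT1 :: "'a ilat_vertex pair_pre_digraph \<Rightarrow> 'a ilat_vertex pair_pre_digraph" where
  "ILAT1 G =
     \<lparr> pverts = Old ` pverts G \<union> New ` pverts G,
       parcs = map_prod Old Old ` parcs G \<union> anticlone_arcs G \<union> (anticlone_arcs G)\<inverse> \<rparr>"

primrec ILAT :: "nat \<Rightarrow> 'a pair_pre_digraph \<Rightarrow> 'a ilat_vertex pair_pre_digraph" where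
  "ILAT 0 G = \<lparr> pverts = Base ` pverts G, parcs = map_prod Base Base ` parcs G \<rparr>"
| "ILAT (Suc l) G = ILAT1 (ILAT l G)"

lemma neighborhood_ILAT1_New:
  assumes "v \<in> pverts G"
  shows "neighborhood (ILAT1 G) (New v) = Old ` (pverts G - closed_neighborhood G v)"
  using assms by (auto simp: neighborhood_def ILAT1_def anticlone_arcs_def)

lemma adjacent_ILAT1_Old:
  "(Old u, Old v) \<in> parcs (ILAT1 G) \<longleftrightarrow> (u, v) \<in> parcs G"
  by (auto simp: ILAT1_def anticlone_arcs_def)

lemma card_ILAT1:
  assumes "finite (pverts G)"
  shows "card (pverts (ILAT1 G)) = 2 * card (pverts G)"
proof -
  have "card (Old ` pverts G \<union> New ` pverts G) = card (Old ` pverts G) + card (New ` pverts G)"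
    using assms by (intro card_Un_disjoint) auto
  then show ?thesis
    by (simp add: ILAT1_def card_image inj_on_def)
qed

lemma pair_graph_ILAT1:
  assumes "pair_graph G"
  shows "pair_graph (ILAT1 G)"
proof -
  interpret pair_graph G by fact
  have "finite (pverts (ILAT1 G))"
    by (simp add: ILAT1_def)
  moreover have sub: "parcs (ILAT1 G) \<subseteq> pverts (ILAT1 G) \<times> pverts (ILAT1 G)"
    by (auto simp: ILAT1_def anticlone_arcs_def dest: in_arcsD1 in_arcsD2)
  ultimately have "finite (parcs (ILAT1 G))"
    by (meson finite_SigmaI finite_subset)
  moreover have "sym (parcs (ILAT1 G))"
    using pair_sym_arcs
    by (auto simp: sym_def symmetric_def ILAT1_def anticlone_arcs_def)
  moreover have "fst e \<noteq> snd e" if "e \<in> parcs (ILAT1 G)" for e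
    using that pair_no_loops by (auto simp: ILAT1_def anticlone_arcs_def)
  ultimately show ?thesis
    using sub \<open>finite (pverts (ILAT1 G))\<close>
    by unfold_locales (auto simp: symmetric_def)
qed

lemma pair_graph_ILAT:
  assumes "pair_graph G"
  shows "pair_graph (ILAT l G)"
proof (induction l)
  case 0
  interpret pair_graph G by fact
  have "sym (parcs G)"
    using pair_sym_arcs by (simp add: symmetric_def)
  then have "sym (map_prod Base Base ` parcs G)"
    by (auto simp: sym_def)
  then show ?case
    by unfold_locales
      (auto simp: symmetric_def dest: in_arcsD1 in_arcsD2 pair_no_loops)
next
  case (Suc l)
  then show ?case by (simp add: pair_graph_ILAT1)
qed


section \<open>Zero forcing\<close>

definition forcing_step :: "'a pair_pre_digraph \<Rightarrow> 'a set \<Rightarrow> 'a set" where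
  "forcing_step G S = S \<union> {u. \<exists>v\<in>S. neighborhood G v - S = {u}}"

definition zero_forcing_set :: "'a pair_pre_digraph \<Rightarrow> 'a set \<Rightarrow> bool" where
  "zero_forcing_set G S \<longleftrightarrow>
     S \<subseteq> pverts G \<and> (\<exists>t. (forcing_step G ^^ t) S = pverts G)"

definition failed_zero_forcing_set :: "'a pair_pre_digraph \<Rightarrow> 'a set \<Rightarrow> bool" where
  "failed_zero_forcing_set G S \<longleftrightarrow> S \<subseteq> pverts G \<and> \<not> zero_forcing_set G S"

text \<open>
  For a finite graph with at least one vertex the maximum is taken over a finite non-empty set:
  the empty set is a failed zero forcing set.
\<close>

definition FZ :: "'a pair_pre_digraph \<Rightarrow> nat" where
  "FZ G = Max (card ` {S. failed_zero_forcing_set G S})"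

lemma failed_zero_forcing_set_empty:
  assumes "pverts G \<noteq> {}"
  shows "failed_zero_forcing_set G {}"
proof -
  have "(forcing_step G ^^ t) {} = {}" for t
    by (induction t) (simp_all add: forcing_step_def)
  then show ?thesis
    using assms by (auto simp: failed_zero_forcing_set_def zero_forcing_set_def)
qed

lemma finite_failed_zero_forcing_sets:
  assumes "finite (pverts G)"
  shows "finite {S. failed_zero_forcing_set G S}"
  using assms by (auto simp: failed_zero_forcing_set_def intro: finite_subset[of _ "Pow (pverts G)"])

end

theory Submission
  imports Defs
begin

text \<open>
  A failed zero forcing set of maximum size is stalled: no forced vertex has exactly one unforced
  neighbor, since otherwise one more step would give a larger failed set. If
  \<open>FZ G = card (pverts G) - 3\<close>, the complement of such a set is a triple \<open>T\<close> met by the closed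
  neighborhood of no vertex outside \<open>T\<close> in exactly one vertex. Moreover \<open>G\<close> then has no true
  twins (distinct vertices with the same closed neighborhood), because removing two true twins leaves
  a stalled set of size \<open>card (pverts G) - 2\<close>. So it suffices to show that after four anticlone
  extensions a stalled triple forces true twins.

  Write \<open>N[w]\<close> for a closed neighborhood and let \<open>T = Old ` A \<union> New ` B\<close> be a triple in
  \<open>ILAT1 G\<close>. Seen from \<open>Old w\<close> it has trace size \<open>card (A \<inter> N[w]) + card (B - N[w])\<close>, and seen
  from \<open>New w\<close> it has trace size \<open>card (A - N[w])\<close>, plus one if \<open>w \<in> B\<close>
  (\<open>card_trace_Old\<close>, \<open>card_trace_New\<close>). A restriction on trace sizes in \<open>ILAT1 G\<close> thus becomes a
  restriction in \<open>G\<close>, with sizes complemented where the levels mix. True twins survive an anticlone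
  extension, so if the top graph has none, no lower level has any. Let the top four levels be
  \<open>ILAT1 K\<close>, \<open>K = ILAT1 J\<close>, \<open>J = ILAT1 I\<close>, \<open>I = ILAT1 F\<close>. Descending:

  \<^item> a stalled triple of \<open>ILAT1 K\<close> yields a triple of \<open>K\<close> that no \<open>N[w]\<close> meets in exactly two
    vertices (\<open>stalled_triple_ILAT1_ILAT1\<close>);
  \<^item> such a triple of \<open>K\<close> yields a triple of \<open>J\<close> that no \<open>N[w]\<close> meets in exactly one vertex
    (\<open>trace_avoiding_two_ILAT1_ILAT1\<close>);
  \<^item> such a triple of \<open>J\<close> is in particular stalled, so the first step applies to it again; together
    the two restrictions leave only the sizes 0 and 3 in \<open>I\<close>, and any two vertices of the triple
    are true twins (\<open>no_trace_avoiding_one_ILAT1_ILAT1\<close>).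

  In the first two steps the triples that mix old and new vertices have to be excluded. This uses
  that the graph one level down is itself an anticlone extension, hence sparse: a closed
  neighborhood contains at most half of the vertices (\<open>card_closed_neighborhood_ILAT1_le\<close>), and
  two adjacent vertices have two common non-neighbors
  (\<open>ILAT1_adjacent_two_common_nonneighbors\<close>).
\<close>

section \<open>Closed neighborhoods and true twins\<close>

lemma closed_neighborhood_subset:
  assumes "pair_graph G" "v \<in> pverts G"
  shows "closed_neighborhood G v \<subseteq> pverts G"
proof -
  interpret pair_graph G by fact
  show ?thesis
    using assms(2) by (auto simp: closed_neighborhood_def neighborhood_def dest: in_arcsD2)
qed

lemma closed_neighborhood_self [simp]: "v \<in> closed_neighborhood G v"
  by (simp add: closed_neighborhood_def)

lemma closed_neighborhood_sym:
  assumes "pair_graph G"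
  shows "u \<in> closed_neighborhood G v \<longleftrightarrow> v \<in> closed_neighborhood G u"
proof -
  interpret pair_graph G by fact
  have "sym (parcs G)"
    using pair_sym_arcs by (simp add: symmetric_def)
  then show ?thesis
    by (auto simp: closed_neighborhood_def neighborhood_def sym_def)
qed

text \<open>
  Closed neighborhoods make the argument uniform: a vertex outside a set sees the same part of it
  through its open and its closed neighborhood, and membership in closed neighborhoods of old and new
  vertices is plain complementation, without exceptions for a vertex and its own anticlone.
\<close>

definition has_true_twins :: "'a pair_pre_digraph \<Rightarrow> bool" where
  "has_true_twins G \<longleftrightarrow>
     (\<exists>x\<in>pverts G. \<exists>y\<in>pverts G. x \<noteq> y \<and> closed_neighborhood G x = closed_neighborhood G y)"

lemma has_true_twinsI:
  assumes G: "pair_graph G" and xy: "x \<in> pverts G" "y \<in> pverts G" "x \<noteq> y"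
    and agree: "\<And>w. w \<in> pverts G \<Longrightarrow>
      x \<in> closed_neighborhood G w \<longleftrightarrow> y \<in> closed_neighborhood G w"
  shows "has_true_twins G"
proof -
  have "w \<in> closed_neighborhood G x \<longleftrightarrow> w \<in> closed_neighborhood G y" for w
    using agree[of w] closed_neighborhood_subset[OF G xy(1)] closed_neighborhood_subset[OF G xy(2)]
      closed_neighborhood_sym[OF G, of w]
    by blast
  then show ?thesis
    using xy by (auto simp: has_true_twins_def)
qed

lemma has_true_twins_if_all_or_nothing:
  assumes G: "pair_graph G" and A: "A \<subseteq> pverts G" "card A \<ge> 2"
    and trace: "\<And>w. w \<in> pverts G \<Longrightarrow>
      card (A \<inter> closed_neighborhood G w) = 0 \<or> card (A \<inter> closed_neighborhood G w) = card A"
  shows "has_true_twins G"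
proof -
  have fin: "finite A"
    using A(2) card.infinite by fastforce
  obtain x y where xy: "x \<in> A" "y \<in> A" "x \<noteq> y"
    using A(2) card_le_Suc0_iff_eq[OF fin] by (auto simp: numeral_2_eq_2)
  show ?thesis
  proof (rule has_true_twinsI[OF G, of x y])
    fix w assume "w \<in> pverts G"
    then have "A \<inter> closed_neighborhood G w = {} \<or> A \<inter> closed_neighborhood G w = A"
      using trace[of w] fin by (metis card_0_eq card_subset_eq finite_Int inf_le1)
    then show "x \<in> closed_neighborhood G w \<longleftrightarrow> y \<in> closed_neighborhood G w"
      using xy by blast
  qed (use xy A in auto)
qed


section \<open>Adjacency in an anticlone extension\<close>

lemma pverts_ILAT1: "pverts (ILAT1 G) = Old ` pverts G \<union> New ` pverts G"
  by (simp add: ILAT1_def)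

lemma closed_neighborhood_ILAT1_Old:
  assumes "pair_graph G" "v \<in> pverts G"
  shows "closed_neighborhood (ILAT1 G) (Old v)
    = Old ` closed_neighborhood G v \<union> New ` (pverts G - closed_neighborhood G v)"
  using assms(2) closed_neighborhood_subset[OF assms] closed_neighborhood_sym[OF assms(1)]
  by (auto simp: closed_neighborhood_def[of "ILAT1 G"] neighborhood_def[of "ILAT1 G"]
      ILAT1_def anticlone_arcs_def)
     (auto simp: closed_neighborhood_def neighborhood_def)

lemma closed_neighborhood_ILAT1_New:
  assumes "v \<in> pverts G"
  shows "closed_neighborhood (ILAT1 G) (New v)
    = insert (New v) (Old ` (pverts G - closed_neighborhood G v))"
  using neighborhood_ILAT1_New[OF assms] by (simp add: closed_neighborhood_def[of "ILAT1 G"])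

lemma mem_closed_neighborhood_ILAT1:
  assumes "pair_graph G" "v \<in> pverts G"
  shows "Old u \<in> closed_neighborhood (ILAT1 G) (Old v) \<longleftrightarrow> u \<in> closed_neighborhood G v"
    and "New u \<in> closed_neighborhood (ILAT1 G) (Old v)
      \<longleftrightarrow> u \<in> pverts G \<and> u \<notin> closed_neighborhood G v"
    and "Old u \<in> closed_neighborhood (ILAT1 G) (New v)
      \<longleftrightarrow> u \<in> pverts G \<and> u \<notin> closed_neighborhood G v"
    and "New u \<in> closed_neighborhood (ILAT1 G) (New v) \<longleftrightarrow> u = v"
  by (auto simp: closed_neighborhood_ILAT1_Old[OF assms] closed_neighborhood_ILAT1_New[OF assms(2)])

text \<open>
  Adjacent twins survive because the anticlones of both miss both of them. Non-adjacent twins would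
  not: the anticlone of one of them is adjacent to the other only.
\<close>

lemma has_true_twins_ILAT1:
  assumes "pair_graph G" "has_true_twins G"
  shows "has_true_twins (ILAT1 G)"
proof -
  obtain x y where "x \<in> pverts G" "y \<in> pverts G" "x \<noteq> y"
      "closed_neighborhood G x = closed_neighborhood G y"
    using assms(2) by (auto simp: has_true_twins_def)
  then have "Old x \<in> pverts (ILAT1 G)" "Old y \<in> pverts (ILAT1 G)" "Old x \<noteq> Old y"
      "closed_neighborhood (ILAT1 G) (Old x) = closed_neighborhood (ILAT1 G) (Old y)"
    by (auto simp: pverts_ILAT1 closed_neighborhood_ILAT1_Old[OF assms(1)])
  then show ?thesis
    unfolding has_true_twins_def by blast
qed

lemma ILAT1_vertex_set_split:
  assumes "finite (pverts G)" "T \<subseteq> pverts (ILAT1 G)"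
  obtains A B where "A \<subseteq> pverts G" "B \<subseteq> pverts G" "T = Old ` A \<union> New ` B"
    "card T = card A + card B"
proof
  let ?A = "{v. Old v \<in> T}" and ?B = "{v. New v \<in> T}"
  show sub: "?A \<subseteq> pverts G" "?B \<subseteq> pverts G"
    using assms(2) by (auto simp: pverts_ILAT1)
  show T: "T = Old ` ?A \<union> New ` ?B"
    using assms(2) by (auto simp: pverts_ILAT1)
  have "card (Old ` ?A \<union> New ` ?B) = card (Old ` ?A) + card (New ` ?B)"
    using finite_subset[OF sub(1) assms(1)] finite_subset[OF sub(2) assms(1)]
    by (intro card_Un_disjoint) auto
  then show "card T = card ?A + card ?B"
    using T by (simp add: card_image inj_on_def)
qed

lemma card_Old_New:
  assumes "finite A" "finite B"
  shows "card (Old ` A \<union> New ` B) = card A + card B"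
  using assms by (subst card_Un_disjoint) (auto simp: card_image inj_on_def)

lemma card_trace_Old:
  assumes "pair_graph G" "A \<subseteq> pverts G" "B \<subseteq> pverts G" "w \<in> pverts G"
  shows "card ((Old ` A \<union> New ` B) \<inter> closed_neighborhood (ILAT1 G) (Old w))
    = card (A \<inter> closed_neighborhood G w) + card (B - closed_neighborhood G w)"
proof -
  interpret pair_graph G by fact
  have "(Old ` A \<union> New ` B) \<inter> closed_neighborhood (ILAT1 G) (Old w)
      = Old ` (A \<inter> closed_neighborhood G w) \<union> New ` (B - closed_neighborhood G w)"
    using assms by (auto simp: closed_neighborhood_ILAT1_Old)
  moreover have "finite A" "finite B"
    using assms finite_subset[OF _ pair_finite_verts] by blast+
  ultimately show ?thesis
    by (simp add: card_Old_New)
qed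

lemma card_trace_New:
  assumes "pair_graph G" "A \<subseteq> pverts G" "B \<subseteq> pverts G" "w \<in> pverts G"
  shows "card ((Old ` A \<union> New ` B) \<inter> closed_neighborhood (ILAT1 G) (New w))
    = card (A - closed_neighborhood G w) + card (B \<inter> {w})"
proof -
  interpret pair_graph G by fact
  have "(Old ` A \<union> New ` B) \<inter> closed_neighborhood (ILAT1 G) (New w)
      = Old ` (A - closed_neighborhood G w) \<union> New ` (B \<inter> {w})"
    using assms by (auto simp: closed_neighborhood_ILAT1_New)
  moreover have "finite A" "finite B"
    using assms finite_subset[OF _ pair_finite_verts] by blast+
  ultimately show ?thesis
    by (simp add: card_Old_New)
qed

text \<open>
  \<open>New w\<close> is adjacent to \<open>Old v\<close> exactly when \<open>Old w\<close> is outside the closed neighborhood of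
  \<open>Old v\<close>, so that closed neighborhood contains one vertex of each pair \<open>Old w\<close>, \<open>New w\<close>. The one
  of \<open>New v\<close> misses \<open>Old v\<close>, which makes room for \<open>New v\<close> itself.
\<close>

lemma card_closed_neighborhood_ILAT1_le:
  assumes G: "pair_graph G" and x: "x \<in> pverts (ILAT1 G)"
  shows "card (closed_neighborhood (ILAT1 G) x) \<le> card (pverts G)"
proof -
  interpret pair_graph G by fact
  obtain v where v: "v \<in> pverts G" "x = Old v \<or> x = New v"
    using x by (auto simp: pverts_ILAT1)
  note sub = closed_neighborhood_subset[OF G v(1)]
  have fin: "finite (closed_neighborhood G v)"
    using sub finite_subset[OF _ pair_finite_verts] by blast
  have le: "card (closed_neighborhood G v) \<le> card (pverts G)"
    using sub by (simp add: card_mono)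
  have pos: "card (closed_neighborhood G v) > 0"
    using fin by (metis card_gt_0_iff closed_neighborhood_self empty_iff)
  from v(2) show ?thesis
  proof
    assume "x = Old v"
    then show ?thesis
      using fin sub le by (simp add: closed_neighborhood_ILAT1_Old[OF G v(1)] card_Old_New card_Diff_subset)
  next
    assume "x = New v"
    moreover have "card (insert (New v) (Old ` (pverts G - closed_neighborhood G v)))
        = Suc (card (pverts G - closed_neighborhood G v))"
      by (subst card_insert_disjoint) (auto simp: card_image inj_on_def)
    ultimately show ?thesis
      using fin sub le pos by (simp add: closed_neighborhood_ILAT1_New[OF v(1)] card_Diff_subset)
  qed
qed

text \<open>
  If both vertices are old, their two anticlones miss both of them. If the vertices are
  \<open>New u\<close> and \<open>Old v\<close>, then \<open>u\<close> and \<open>v\<close> are distinct and non-adjacent, and \<open>Old u\<close> and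
  \<open>New v\<close> are the two common non-neighbors.
\<close>

lemma ILAT1_adjacent_two_common_nonneighbors:
  assumes G: "pair_graph G" and ab: "a \<in> pverts (ILAT1 G)" "b \<in> pverts (ILAT1 G)" "a \<noteq> b"
    and adj: "b \<in> closed_neighborhood (ILAT1 G) a"
  shows "\<exists>p\<in>pverts (ILAT1 G). \<exists>q\<in>pverts (ILAT1 G). p \<noteq> q \<and>
    a \<notin> closed_neighborhood (ILAT1 G) p \<and> b \<notin> closed_neighborhood (ILAT1 G) p \<and>
    a \<notin> closed_neighborhood (ILAT1 G) q \<and> b \<notin> closed_neighborhood (ILAT1 G) q"
proof -
  note sym = closed_neighborhood_sym[OF G]
  have mixed: ?thesis if uv: "u \<in> pverts G" "v \<in> pverts G" "u \<notin> closed_neighborhood G v"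
    and "{a, b} = {New u, Old v}" for u v
  proof -
    have "v \<notin> closed_neighborhood G u" "u \<noteq> v"
      using uv sym[of u v] by auto
    then have "New u \<notin> closed_neighborhood (ILAT1 G) p \<and> Old v \<notin> closed_neighborhood (ILAT1 G) p"
      if "p = New v \<or> p = Old u" for p
      using that uv by (auto simp: closed_neighborhood_ILAT1_Old[OF G] closed_neighborhood_ILAT1_New)
    moreover have "New v \<in> pverts (ILAT1 G)" "Old u \<in> pverts (ILAT1 G)"
      using uv by (auto simp: pverts_ILAT1)
    ultimately show ?thesis
      using that(4) ilat_vertex.distinct(5)[of u v] by (metis doubleton_eq_iff)
  qed
  obtain u where u: "u \<in> pverts G" "a = Old u \<or> a = New u"
    using ab by (auto simp: pverts_ILAT1)
  obtain v where v: "v \<in> pverts G" "b = Old v \<or> b = New v"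
    using ab by (auto simp: pverts_ILAT1)
  consider "a = Old u" "b = Old v" | "a = New u" "b = Old v" | "a = Old u" "b = New v"
    | "a = New u" "b = New v"
    using u(2) v(2) by blast
  then show ?thesis
  proof cases
    case 1
    then have "v \<in> closed_neighborhood G u" "u \<in> closed_neighborhood G v"
      using adj u v sym[of u v] by (auto simp: mem_closed_neighborhood_ILAT1[OF G])
    then show ?thesis
      using 1 u v ab(3) by (intro bexI[of _ "New u"] bexI[of _ "New v"])
        (auto simp: mem_closed_neighborhood_ILAT1[OF G] pverts_ILAT1)
  next
    case 2
    then show ?thesis
      using adj u v sym[of u v]
      by (intro mixed[of u v]) (auto simp: mem_closed_neighborhood_ILAT1[OF G])
  next
    case 3
    then show ?thesis
      using adj u v by (intro mixed[of v u]) (auto simp: mem_closed_neighborhood_ILAT1[OF G])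
  next
    case 4
    then show ?thesis
      using adj u v ab(3) by (auto simp: mem_closed_neighborhood_ILAT1[OF G])
  qed
qed

text \<open>
  The bound of half the vertices excludes a dominating vertex, and a vertex with at most two
  non-neighbors exists only if \<open>G\<close> has at most two vertices. The same bound then gives closed
  neighborhoods of size at most two, so the adjacent vertices \<open>b\<close> and \<open>c\<close> form a component.
\<close>

lemma ILAT1_near_dominating_vertex:
  assumes G: "pair_graph G" "pverts G \<noteq> {}"
    and abc: "a \<in> pverts (ILAT1 G)" "b \<in> pverts (ILAT1 G)" "c \<in> pverts (ILAT1 G)" "b \<noteq> c"
    and dom: "pverts (ILAT1 G) \<subseteq> closed_neighborhood (ILAT1 G) a \<union> {b, c}"
    and dom_or_adj: "pverts (ILAT1 G) \<subseteq> closed_neighborhood (ILAT1 G) a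
      \<or> c \<in> closed_neighborhood (ILAT1 G) b"
  shows "has_true_twins (ILAT1 G)"
proof -
  interpret pair_graph G by fact
  let ?N = "closed_neighborhood (ILAT1 G)"
  note H = pair_graph_ILAT1[OF G(1)]
  have card: "card (pverts (ILAT1 G)) = 2 * card (pverts G)" "card (pverts G) > 0"
    using G(2) by (simp_all add: card_ILAT1 card_gt_0_iff)
  have finV: "finite (pverts (ILAT1 G))"
    by (simp add: pverts_ILAT1)
  have fin: "finite (?N x)" if "x \<in> pverts (ILAT1 G)" for x
    using closed_neighborhood_subset[OF H that] finV by (rule finite_subset)
  note le = card_closed_neighborhood_ILAT1_le[OF G(1)]
  have "\<not> pverts (ILAT1 G) \<subseteq> ?N a"
    using card_mono[OF fin[OF abc(1)], of "pverts (ILAT1 G)"] le[OF abc(1)] card by auto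
  then have adj: "c \<in> ?N b" "b \<in> ?N c"
    using dom_or_adj closed_neighborhood_sym[OF H] by auto
  have "card (pverts (ILAT1 G)) \<le> card (?N a \<union> {b, c})"
    using dom fin[OF abc(1)] by (intro card_mono) auto
  also have "\<dots> \<le> card (?N a) + card {b, c}"
    by (rule card_Un_le)
  also have "card {b, c} = 2"
    using abc(4) by simp
  finally have two: "card (pverts G) \<le> 2"
    using card le[OF abc(1)] by linarith
  have "?N x = {b, c}" if "x = b \<or> x = c" for x
  proof (rule card_seteq[symmetric])
    have x: "x \<in> pverts (ILAT1 G)"
      using that abc by auto
    then show "finite (?N x)"
      by (rule fin)
    show "{b, c} \<subseteq> ?N x"
      using that adj by auto
    show "card (?N x) \<le> card {b, c}"
      using le[OF x] two abc(4) by simp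
  qed
  then have "?N b = ?N c"
    by simp
  then show ?thesis
    using abc unfolding has_true_twins_def by blast
qed


section \<open>Triples met in a restricted number of vertices\<close>

text \<open>
  In contrast to \<open>stalled_complement\<close> below, this restricts the traces seen from all vertices,
  those of \<open>T\<close> included.
\<close>

definition avoids_trace_size :: "'a pair_pre_digraph \<Rightarrow> nat \<Rightarrow> 'a set \<Rightarrow> bool" where
  "avoids_trace_size G k T \<longleftrightarrow> (\<forall>w\<in>pverts G. card (T \<inter> closed_neighborhood G w) \<noteq> k)"

definition stalled_complement :: "'a pair_pre_digraph \<Rightarrow> 'a set \<Rightarrow> bool" where
  "stalled_complement G U \<longleftrightarrow>
     U \<subseteq> pverts G \<and> (\<forall>w\<in>pverts G - U. card (U \<inter> closed_neighborhood G w) \<noteq> 1)"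

lemma card_Diff_eq:
  assumes "finite A"
  shows "card (A - B) = card A - card (A \<inter> B)"
  using assms by (simp add: card_Diff_subset_Int)

lemma card_Int_le_left:
  assumes "finite A"
  shows "card (A \<inter> B) \<le> card A"
  using assms by (simp add: card_mono)

text \<open>
  A triple of old vertices is restricted through the new vertices, all of which lie outside it, and a
  triple of new ones through the old vertices; both times the complement in the triple cannot have
  size one. In the mixed cases either the two old vertices are true twins, or the single old vertex
  comes from a vertex of \<open>K\<close> adjacent to all others but at most two, and then the extremal sparsity
  of \<open>K = ILAT1 J\<close> forces true twins.
\<close>

lemma stalled_triple_ILAT1_ILAT1:
  assumes J: "pair_graph J" "pverts J \<noteq> {}" and K: "K = ILAT1 J"
    and no: "\<not> has_true_twins K"
    and T: "stalled_complement (ILAT1 K) T" "card T = 3"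
  obtains A where "A \<subseteq> pverts K" "card A = 3" "avoids_trace_size K 2 A"
    "T = Old ` A \<or> T = New ` A"
proof -
  have pK: "pair_graph K"
    using pair_graph_ILAT1[OF J(1)] K by simp
  interpret pair_graph K by fact
  let ?N = "closed_neighborhood K"
  note sym = closed_neighborhood_sym[OF pK]
  have "T \<subseteq> pverts (ILAT1 K)"
    using T by (simp add: stalled_complement_def)
  then obtain A B where AB: "A \<subseteq> pverts K" "B \<subseteq> pverts K" and TAB: "T = Old ` A \<union> New ` B"
      and "card T = card A + card B"
    using ILAT1_vertex_set_split[of K T] pair_finite_verts by metis
  then have cards: "card A + card B = 3"
    using T by simp
  have fin: "finite A" "finite B"
    using AB finite_subset[OF _ pair_finite_verts] by blast+
  have old: "card (A \<inter> ?N w) + card (B - ?N w) \<noteq> 1" if "w \<in> pverts K" "w \<notin> A" for w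
    using T(1) that card_trace_Old[OF pK AB that(1)]
    by (auto simp: stalled_complement_def TAB pverts_ILAT1)
  have new: "card (A - ?N w) + card (B \<inter> {w}) \<noteq> 1" if "w \<in> pverts K" "w \<notin> B" for w
    using T(1) that card_trace_New[OF pK AB that(1)]
    by (auto simp: stalled_complement_def TAB pverts_ILAT1)
  consider "card A = 0" "card B = 3" | "card A = 3" "card B = 0"
    | "card A = 2" "card B = 1" | "card A = 1" "card B = 2"
    using cards by linarith
  then show ?thesis
  proof cases
    case 1
    then have "A = {}" using fin by simp
    have "card (B \<inter> ?N w) \<noteq> 2" if "w \<in> pverts K" for w
      using old[OF that] 1 \<open>A = {}\<close> fin by (simp add: card_Diff_eq)
    then show ?thesis
      using 1 AB TAB \<open>A = {}\<close> by (intro that[of B]) (auto simp: avoids_trace_size_def)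
  next
    case 2
    then have "B = {}" using fin by simp
    have "card (A \<inter> ?N w) \<noteq> 2" if "w \<in> pverts K" for w
      using new[OF that] 2 \<open>B = {}\<close> fin by (simp add: card_Diff_eq)
    then show ?thesis
      using 2 AB TAB \<open>B = {}\<close> by (intro that[of A]) (auto simp: avoids_trace_size_def)
  next
    case 3
    obtain c where c: "B = {c}"
      using 3 card_1_singletonE by blast
    have off_c: "card (A \<inter> ?N w) \<noteq> 1" if "w \<in> pverts K" "w \<noteq> c" for w
      using new[of w] that 3 c fin by (simp add: card_Diff_eq)
    (* The anticlone of c is unforced and restricts nothing, so c needs a separate argument. *)
    have at_c: "card (A \<inter> ?N c) \<noteq> 1"
    proof (cases "c \<in> A")
      case False
      then show ?thesis
        using old[of c] c AB by simp
    next
      case True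
      then obtain b where b: "A = {b, c}" "b \<noteq> c"
        using 3 by (metis card_2_iff insert_commute insertE singletonD)
      then show ?thesis
        using off_c[of b] AB sym[of b c] by (auto simp: Int_insert_left split: if_splits)
    qed
    have "has_true_twins K"
    proof (rule has_true_twins_if_all_or_nothing[OF pK AB(1)])
      fix w assume "w \<in> pverts K"
      then have "card (A \<inter> ?N w) \<noteq> 1"
        using off_c at_c by metis
      then show "card (A \<inter> ?N w) = 0 \<or> card (A \<inter> ?N w) = card A"
        using card_Int_le_left[OF fin(1), of "?N w"] 3 by linarith
    qed (use 3 in simp)
    then show ?thesis using no by simp
  next
    case 4
    obtain a where a: "A = {a}"
      using 4 card_1_singletonE by blast
    obtain b c where bc: "B = {b, c}" "b \<noteq> c"
      using 4 by (meson card_2_iff)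
    have V: "a \<in> pverts K" "b \<in> pverts K" "c \<in> pverts K"
      using a bc AB by auto
    have dom: "a \<in> ?N w" if "w \<in> pverts K" "w \<noteq> b" "w \<noteq> c" for w
      using new[of w] that a bc by (auto simp: insert_Diff_if split: if_splits)
    have old': "card ({a} \<inter> ?N w) + card ({b, c} - ?N w) \<noteq> 1" if "w \<in> pverts K" "w \<noteq> a" for w
      using old[of w] that a bc by simp
    (* If a = b, then Old c would see exactly one of Old b and New b, and not New c, so its trace
       would have size one; likewise for a = c and Old b. *)
    have neq: "a \<noteq> b" "a \<noteq> c"
      using old'[of c] old'[of b] V bc(2) sym[of b c]
      by (auto simp: Int_insert_left insert_Diff_if split: if_splits)
    have "a \<in> ?N b \<longleftrightarrow> b \<notin> ?N c" "a \<in> ?N c \<longleftrightarrow> b \<notin> ?N c"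
      using old'[of c] old'[of b] V neq bc(2) sym[of b c]
      by (auto simp: Int_insert_left insert_Diff_if split: if_splits)
    then have "pverts K \<subseteq> ?N a \<union> {b, c}" "pverts K \<subseteq> ?N a \<or> c \<in> ?N b"
      using dom sym[of _ a] sym[of b c] by blast+
    then have "has_true_twins K"
      using ILAT1_near_dominating_vertex[OF J, of a b c] V bc(2) K by simp
    then show ?thesis using no by simp
  qed
qed

text \<open>
  This is the pattern that a triple \<open>Old a\<close>, \<open>New x\<close>, \<open>New y\<close> avoiding trace size two leaves one
  level below: \<open>both\<close> and \<open>some\<close> say what \<open>Old w\<close> sees, and that \<open>a\<close> equals or is adjacent to
  both \<open>x\<close> and \<open>y\<close> is what \<open>New x\<close> and \<open>New y\<close> see. If \<open>a\<close>, \<open>x\<close>, \<open>y\<close> are all old, then \<open>Old w\<close> and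
  \<open>New w\<close> see complementary parts of them, so \<open>both\<close> applies to one of the two and makes \<open>x\<close> and
  \<open>y\<close> twins. Otherwise the anticlone of one of the old vertices sees none of \<open>a\<close>, \<open>x\<close>, \<open>y\<close>,
  against \<open>some\<close>.
\<close>

lemma no_mixed_trace_pattern_ILAT1:
  assumes G: "pair_graph G" and no: "\<not> has_true_twins (ILAT1 G)"
    and V: "a \<in> pverts (ILAT1 G)" "x \<in> pverts (ILAT1 G)" "y \<in> pverts (ILAT1 G)" "x \<noteq> y"
    and ax: "a \<in> closed_neighborhood (ILAT1 G) x" "a \<in> closed_neighborhood (ILAT1 G) y"
    and both: "\<And>w. w \<in> pverts (ILAT1 G) \<Longrightarrow> a \<in> closed_neighborhood (ILAT1 G) w \<Longrightarrow>
      x \<in> closed_neighborhood (ILAT1 G) w \<longleftrightarrow> y \<in> closed_neighborhood (ILAT1 G) w"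
    and some: "\<And>w. w \<in> pverts (ILAT1 G) \<Longrightarrow> a \<notin> closed_neighborhood (ILAT1 G) w \<Longrightarrow>
      x \<in> closed_neighborhood (ILAT1 G) w \<or> y \<in> closed_neighborhood (ILAT1 G) w"
  shows False
proof -
  let ?N = "closed_neighborhood (ILAT1 G)"
  note sym = closed_neighborhood_sym[OF G]
  note nbs = mem_closed_neighborhood_ILAT1[OF G] pverts_ILAT1
  have xy: "x \<in> ?N y" "y \<in> ?N x"
    using both[OF V(2) ax(1)] both[OF V(3) ax(2)] by simp_all
  have not_New_a_Old: False
    if "u \<in> pverts G" "p \<in> pverts G" "q \<in> pverts G" "a = New u" "x = Old p" "y = Old q" for u p q
    using some[of "New p"] that ax xy sym[of p q] sym[of u p] by (auto simp: nbs)
  have not_New_Old_a: False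
    if "u \<in> pverts G" "p \<in> pverts G" "q \<in> pverts G" "a = Old p" "x = New u \<and> y = Old q \<or> x = Old q \<and> y = New u" for u p q
  proof -
    have "u \<notin> closed_neighborhood G p" "p \<in> closed_neighborhood G q"
      using that ax sym[of p u] by (auto simp: nbs)
    then show False
      using some[of "New p"] that sym[of p q] by (auto simp: nbs)
  qed
  have not_New_New: False
    if "u \<in> pverts G" "p \<in> pverts G" "a = New u" "x = New u \<and> y = Old p \<or> x = Old p \<and> y = New u" for u p
  proof -
    have "u \<notin> closed_neighborhood G p"
      using that ax by (auto simp: nbs)
    moreover from this have "u \<noteq> p"
      by auto
    ultimately show False
      using some[of "New p"] that by (auto simp: nbs)
  qed
  obtain a' where a': "a' \<in> pverts G" "a = Old a' \<or> a = New a'"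
    using V by (auto simp: pverts_ILAT1)
  obtain x' where x': "x' \<in> pverts G" "x = Old x' \<or> x = New x'"
    using V by (auto simp: pverts_ILAT1)
  obtain y' where y': "y' \<in> pverts G" "y = Old y' \<or> y = New y'"
    using V by (auto simp: pverts_ILAT1)
  have not_both_New: "\<not> (x = New x' \<and> y = New y')"
    using xy x' y' V(4) by (auto simp: nbs)
  have New_eq: "x = New x' \<Longrightarrow> a = New a' \<Longrightarrow> x' = a'" "y = New y' \<Longrightarrow> a = New a' \<Longrightarrow> y' = a'"
    using ax x' y' a' by (auto simp: nbs)
  consider "a = Old a'" "x = Old x'" "y = Old y'" | "a = New a'" "x = Old x'" "y = Old y'"
    | "a = Old a'" "x = New x'" "y = Old y'" | "a = Old a'" "x = Old x'" "y = New y'"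
    | "a = New a'" "x = New a'" "y = Old y'" | "a = New a'" "x = Old x'" "y = New a'"
    using a'(2) x'(2) y'(2) not_both_New New_eq by blast
  then show False
  proof cases
    case 1
    have "has_true_twins G"
    proof (rule has_true_twinsI[OF G x'(1) y'(1)])
      fix w assume w: "w \<in> pverts G"
      show "x' \<in> closed_neighborhood G w \<longleftrightarrow> y' \<in> closed_neighborhood G w"
        using both[of "Old w"] both[of "New w"] 1 w a' x' y' by (auto simp: nbs)
    qed (use 1 V in auto)
    then show False
      using has_true_twins_ILAT1[OF G] no by simp
  qed (use not_New_a_Old not_New_Old_a not_New_New a' x' y' in blast)+
qed

text \<open>
  For a triple of new vertices, seeing two of them from \<open>Old w\<close> means having exactly one of the
  originals in \<open>N[w]\<close>, which is how the avoided size two turns into one. For a triple of old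
  vertices both sizes are avoided, which makes them twins. Two old vertices and one new one would
  give adjacent vertices of \<open>J\<close> with at most one common non-neighbor; one old vertex and two new
  ones give the pattern just excluded.
\<close>

lemma trace_avoiding_two_ILAT1_ILAT1:
  assumes I: "pair_graph I" and J: "J = ILAT1 I"
    and no: "\<not> has_true_twins J"
    and T: "T \<subseteq> pverts (ILAT1 J)" "card T = 3" "avoids_trace_size (ILAT1 J) 2 T"
  obtains B where "B \<subseteq> pverts J" "card B = 3" "avoids_trace_size J 1 B"
proof -
  have pJ: "pair_graph J"
    using pair_graph_ILAT1[OF I] J by simp
  interpret pair_graph J by fact
  let ?N = "closed_neighborhood J"
  note sym = closed_neighborhood_sym[OF pJ]
  obtain A B where AB: "A \<subseteq> pverts J" "B \<subseteq> pverts J" and TAB: "T = Old ` A \<union> New ` B"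
      and "card T = card A + card B"
    using T(1) ILAT1_vertex_set_split[of J T] pair_finite_verts by metis
  then have cards: "card A + card B = 3"
    using T by simp
  have fin: "finite A" "finite B"
    using AB finite_subset[OF _ pair_finite_verts] by blast+
  have old: "card (A \<inter> ?N w) + card (B - ?N w) \<noteq> 2" if "w \<in> pverts J" for w
    using T(3) that card_trace_Old[OF pJ AB that]
    by (auto simp: avoids_trace_size_def TAB pverts_ILAT1)
  have new: "card (A - ?N w) + card (B \<inter> {w}) \<noteq> 2" if "w \<in> pverts J" for w
    using T(3) that card_trace_New[OF pJ AB that]
    by (auto simp: avoids_trace_size_def TAB pverts_ILAT1)
  consider "card A = 0" "card B = 3" | "card A = 3" "card B = 0"
    | "card A = 2" "card B = 1" | "card A = 1" "card B = 2"
    using cards by linarith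
  then show ?thesis
  proof cases
    case 1
    then have "A = {}" using fin by simp
    have "card (B \<inter> ?N w) \<noteq> 1" if "w \<in> pverts J" for w
      using old[OF that] 1 \<open>A = {}\<close> fin by (simp add: card_Diff_eq)
    then show ?thesis
      using 1 AB by (intro that[of B]) (auto simp: avoids_trace_size_def)
  next
    case 2
    then have "B = {}" using fin by simp
    have "has_true_twins J"
    proof (rule has_true_twins_if_all_or_nothing[OF pJ AB(1)])
      fix w assume "w \<in> pverts J"
      then have "card (A \<inter> ?N w) \<noteq> 1" "card (A \<inter> ?N w) \<noteq> 2"
        using old[of w] new[of w] 2 \<open>B = {}\<close> fin by (simp_all add: card_Diff_eq)
      then show "card (A \<inter> ?N w) = 0 \<or> card (A \<inter> ?N w) = card A"
        using card_Int_le_left[OF fin(1), of "?N w"] 2 by linarith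
    qed (use 2 in simp)
    then show ?thesis using no by simp
  next
    case 3
    obtain a b where ab: "A = {a, b}" "a \<noteq> b"
      using 3 by (meson card_2_iff)
    obtain x where x: "B = {x}"
      using 3 card_1_singletonE by blast
    have V: "a \<in> pverts J" "b \<in> pverts J" "x \<in> pverts J"
      using ab x AB by auto
    have cover: "a \<in> ?N w \<or> b \<in> ?N w" if "w \<in> pverts J" "w \<noteq> x" for w
      using new[of w] that ab x by (auto simp: insert_Diff_if split: if_splits)
    have "a \<notin> ?N x" "b \<notin> ?N x"
      using new[OF V(3)] old[OF V(3)] ab x
      by (auto simp: Int_insert_left insert_Diff_if split: if_splits)
    then have "b \<in> ?N a"
      using old[OF V(1)] ab x sym[of x a]
      by (auto simp: Int_insert_left insert_Diff_if split: if_splits)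
    then show ?thesis
      using ILAT1_adjacent_two_common_nonneighbors[OF I, of a b] V ab(2) cover J by metis
  next
    case 4
    obtain a where a: "A = {a}"
      using 4 card_1_singletonE by blast
    obtain x y where xy: "B = {x, y}" "x \<noteq> y"
      using 4 by (meson card_2_iff)
    have V: "a \<in> pverts J" "x \<in> pverts J" "y \<in> pverts J"
      using a xy AB by auto
    have "a \<in> ?N x" "a \<in> ?N y"
      using new[OF V(2)] new[OF V(3)] a xy by (auto simp: insert_Diff_if split: if_splits)
    moreover have "x \<in> ?N w \<longleftrightarrow> y \<in> ?N w" if "w \<in> pverts J" "a \<in> ?N w" for w
      using old[of w] that a xy by (auto simp: Int_insert_left insert_Diff_if split: if_splits)
    moreover have "x \<in> ?N w \<or> y \<in> ?N w" if "w \<in> pverts J" "a \<notin> ?N w" for w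
      using old[of w] that a xy by (auto simp: Int_insert_left insert_Diff_if split: if_splits)
    ultimately have False
      using no_mixed_trace_pattern_ILAT1[OF I, of a x y] no V xy(2) J by blast
    then show ?thesis ..
  qed
qed

text \<open>
  A triple of new vertices is independent, so each of them sees exactly one vertex of it. Hence the
  triple is old, and avoids size two in \<open>I\<close> as a stalled triple and size one by assumption.
\<close>

lemma no_trace_avoiding_one_ILAT1_ILAT1:
  assumes F: "pair_graph F" "pverts F \<noteq> {}" and I: "I = ILAT1 F"
    and no: "\<not> has_true_twins I"
    and T: "T \<subseteq> pverts (ILAT1 I)" "card T = 3"
  shows "\<not> avoids_trace_size (ILAT1 I) 1 T"
proof
  assume avoid: "avoids_trace_size (ILAT1 I) 1 T"
  have pI: "pair_graph I"
    using pair_graph_ILAT1[OF F(1)] I by simp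
  interpret pair_graph I by fact
  let ?N = "closed_neighborhood I"
  have "stalled_complement (ILAT1 I) T"
    using avoid T by (auto simp: stalled_complement_def avoids_trace_size_def)
  then obtain A where A: "A \<subseteq> pverts I" "card A = 3" "avoids_trace_size I 2 A"
      and TA: "T = Old ` A \<or> T = New ` A"
    using stalled_triple_ILAT1_ILAT1[OF F I no] T(2) by metis
  have fin: "finite A"
    using A finite_subset[OF _ pair_finite_verts] by blast
  from TA show False
  proof
    assume T: "T = New ` A"
    obtain x where x: "x \<in> A"
      using A(2) by fastforce
    then have "card (T \<inter> closed_neighborhood (ILAT1 I) (New x)) = 1"
      using card_trace_New[OF pI, of "{}" A x] A T by auto
    then show False
      using avoid x A by (auto simp: avoids_trace_size_def pverts_ILAT1)
  next
    assume T: "T = Old ` A"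
    have "has_true_twins I"
    proof (rule has_true_twins_if_all_or_nothing[OF pI A(1)])
      fix w assume w: "w \<in> pverts I"
      then have "card (A \<inter> ?N w) \<noteq> 1" "card (A \<inter> ?N w) \<noteq> 2"
        using avoid A(3) card_trace_Old[OF pI A(1), of "{}" w] T
        by (auto simp: avoids_trace_size_def pverts_ILAT1)
      then show "card (A \<inter> ?N w) = 0 \<or> card (A \<inter> ?N w) = card A"
        using card_Int_le_left[OF fin, of "?N w"] A(2) by linarith
    qed (use A in simp)
    then show False
      using no by simp
  qed
qed

lemma has_true_twins_if_stalled_triple_ILAT1_4:
  assumes F: "pair_graph F" "pverts F \<noteq> {}"
    and T: "stalled_complement (ILAT1 (ILAT1 (ILAT1 (ILAT1 F)))) T" "card T = 3"
  shows "has_true_twins (ILAT1 (ILAT1 (ILAT1 (ILAT1 F))))"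
proof (rule ccontr)
  let ?I = "ILAT1 F" let ?J = "ILAT1 ?I" let ?K = "ILAT1 ?J"
  assume no: "\<not> has_true_twins (ILAT1 ?K)"
  have p: "pair_graph ?I" "pair_graph ?J" "pair_graph ?K"
    using F(1) by (simp_all add: pair_graph_ILAT1)
  have ne: "pverts ?J \<noteq> {}"
    using F(2) by (simp add: pverts_ILAT1)
  have no': "\<not> has_true_twins ?I" "\<not> has_true_twins ?J" "\<not> has_true_twins ?K"
    using no has_true_twins_ILAT1 p by blast+
  obtain A where "A \<subseteq> pverts ?K" "card A = 3" "avoids_trace_size ?K 2 A"
    using stalled_triple_ILAT1_ILAT1[OF p(2) ne refl no'(3) T] by metis
  then obtain B where "B \<subseteq> pverts ?J" "card B = 3" "avoids_trace_size ?J 1 B"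
    using trace_avoiding_two_ILAT1_ILAT1[OF p(1) refl no'(2)] by metis
  then show False
    using no_trace_avoiding_one_ILAT1_ILAT1[OF F refl no'(1)] by metis
qed


section \<open>Failed zero forcing sets\<close>

lemma failed_zero_forcing_set_if_stalled:
  assumes "forcing_step G S = S" "S \<subset> pverts G"
  shows "failed_zero_forcing_set G S"
proof -
  have "(forcing_step G ^^ t) S = S" for t
    using assms(1) by (induction t) simp_all
  then show ?thesis
    using assms(2) by (auto simp: failed_zero_forcing_set_def zero_forcing_set_def)
qed

lemma card_le_FZ:
  assumes "finite (pverts G)" "failed_zero_forcing_set G S"
  shows "card S \<le> FZ G"
  using assms finite_failed_zero_forcing_sets[OF assms(1)] by (auto simp: FZ_def intro: Max_ge)

lemma FZ_attained_by_stalled_set: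
  assumes G: "pair_graph G" "pverts G \<noteq> {}"
  obtains S where "S \<subset> pverts G" "card S = FZ G" "forcing_step G S = S"
proof -
  interpret pair_graph G by fact
  let ?F = "{S. failed_zero_forcing_set G S}"
  have "FZ G \<in> card ` ?F"
    unfolding FZ_def using finite_failed_zero_forcing_sets[OF pair_finite_verts]
      failed_zero_forcing_set_empty[OF G(2)] by (intro Max_in) auto
  then obtain S where S: "failed_zero_forcing_set G S" "card S = FZ G"
    by auto
  then have sub: "S \<subseteq> pverts G" and never: "(forcing_step G ^^ t) S \<noteq> pverts G" for t
    by (auto simp: failed_zero_forcing_set_def zero_forcing_set_def)
  have "forcing_step G S \<subseteq> pverts G"
    using sub by (auto simp: forcing_step_def neighborhood_def dest: in_arcsD2)
  moreover have "(forcing_step G ^^ t) (forcing_step G S) \<noteq> pverts G" for t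
    using never[of "Suc t"] by (simp add: funpow_swap1)
  ultimately have failed: "failed_zero_forcing_set G (forcing_step G S)"
    by (auto simp: failed_zero_forcing_set_def zero_forcing_set_def)
  then have "card (forcing_step G S) \<le> card S"
    using card_le_FZ[OF pair_finite_verts] S by simp
  moreover have "finite (forcing_step G S)"
    using failed finite_subset[OF _ pair_finite_verts]
    by (auto simp: failed_zero_forcing_set_def)
  ultimately have "forcing_step G S = S"
    by (intro card_seteq[symmetric]) (auto simp: forcing_step_def)
  moreover have "S \<noteq> pverts G"
    using never[of 0] by simp
  ultimately show ?thesis
    using that S sub by blast
qed

lemma stalled_complement_if_stalled:
  assumes G: "pair_graph G" and S: "S \<subseteq> pverts G" "forcing_step G S = S"
  shows "stalled_complement G (pverts G - S)"
proof -
  have "card ((pverts G - S) \<inter> closed_neighborhood G w) \<noteq> 1" if w: "w \<in> S" for w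
  proof
    assume "card ((pverts G - S) \<inter> closed_neighborhood G w) = 1"
    then obtain u where "(pverts G - S) \<inter> closed_neighborhood G w = {u}"
      by (rule card_1_singletonE)
    moreover have "neighborhood G w - S = (pverts G - S) \<inter> closed_neighborhood G w"
      using w S(1) closed_neighborhood_subset[OF G, of w] by (auto simp: closed_neighborhood_def)
    ultimately have "u \<in> forcing_step G S" "u \<notin> S"
      using w by (auto simp: forcing_step_def)
    then show False
      using S(2) by simp
  qed
  then show ?thesis
    using S(1) by (auto simp: stalled_complement_def)
qed

lemma FZ_ge_if_true_twins:
  assumes G: "pair_graph G" and "has_true_twins G"
  shows "card (pverts G) - 2 \<le> FZ G"
proof -
  interpret pair_graph G by fact
  obtain x y where xy: "x \<in> pverts G" "y \<in> pverts G" "x \<noteq> y"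
      "closed_neighborhood G x = closed_neighborhood G y"
    using assms(2) by (auto simp: has_true_twins_def)
  let ?S = "pverts G - {x, y}"
  have "neighborhood G v - ?S \<noteq> {u}" if v: "v \<in> ?S" for u v
  proof -
    have "x \<in> closed_neighborhood G v \<longleftrightarrow> y \<in> closed_neighborhood G v"
      using xy(4) closed_neighborhood_sym[OF G, of x v] closed_neighborhood_sym[OF G, of y v] by simp
    then have agree: "x \<in> neighborhood G v \<longleftrightarrow> y \<in> neighborhood G v"
      using v by (auto simp: closed_neighborhood_def)
    show ?thesis
    proof
      assume eq: "neighborhood G v - ?S = {u}"
      then have u: "u \<in> neighborhood G v" "u \<notin> ?S"
        by blast+
      then have "u \<in> closed_neighborhood G v"
        by (simp add: closed_neighborhood_def)
      then have "u = x \<or> u = y"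
        using u(2) v closed_neighborhood_subset[OF G, of v] by blast
      then have "x \<in> neighborhood G v - ?S" "y \<in> neighborhood G v - ?S"
        using u(1) agree by blast+
      then have "x \<in> {u}" "y \<in> {u}"
        unfolding eq by blast+
      then show False
        using xy(3) by simp
    qed
  qed
  then have "forcing_step G ?S = ?S"
    by (auto simp: forcing_step_def)
  then have "failed_zero_forcing_set G ?S"
    using xy by (intro failed_zero_forcing_set_if_stalled) auto
  moreover have "card ?S = card (pverts G) - 2"
    using xy by (simp add: card_Diff_subset)
  ultimately show ?thesis
    using card_le_FZ[OF pair_finite_verts] by metis
qed

text \<open>
  The equation gives both a witness of the maximum and, through maximality, the absence of the larger
  failed set that true twins would provide.
\<close>

lemma FZ_eq_card_minus_3D:
  assumes G: "pair_graph G" "pverts G \<noteq> {}"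
    and FZ: "int (FZ G) = int (card (pverts G)) - 3"
  obtains T where "stalled_complement G T" "card T = 3" "\<not> has_true_twins G"
proof -
  interpret pair_graph G by fact
  obtain S where S: "S \<subset> pverts G" "card S = FZ G" "forcing_step G S = S"
    using FZ_attained_by_stalled_set[OF G] .
  have "finite S"
    using S(1) finite_subset[OF _ pair_finite_verts] by blast
  then have "card (pverts G - S) = card (pverts G) - card S"
    using S(1) by (intro card_Diff_subset) auto
  then have "card (pverts G - S) = 3"
    using FZ S(2) by simp
  moreover have "stalled_complement G (pverts G - S)"
    using S by (intro stalled_complement_if_stalled[OF G(1)]) auto
  moreover have "\<not> has_true_twins G"
    using FZ_ge_if_true_twins[OF G(1)] FZ by auto
  ultimately show ?thesis
    using that by blast
qed

lemma pverts_ILAT_nonempty: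
  assumes "pverts G \<noteq> {}"
  shows "pverts (ILAT l G) \<noteq> {}"
  using assms by (induction l) (simp_all add: pverts_ILAT1)

theorem theorem3p3:
  fixes G :: "'a pair_pre_digraph" and l :: nat
  assumes "pair_graph G" and "pverts G \<noteq> {}" and "l \<ge> 4"
  shows "int (FZ (ILAT l G)) \<noteq> int (card (pverts (ILAT l G))) - 3"
proof
  assume eq: "int (FZ (ILAT l G)) = int (card (pverts (ILAT l G))) - 3"
  obtain m where "l = m + 4"
    using le_Suc_ex[OF assms(3)] by (auto simp: add.commute)
  then have l: "ILAT l G = ILAT1 (ILAT1 (ILAT1 (ILAT1 (ILAT m G))))"
    by (simp add: numeral_eq_Suc)
  obtain T where "stalled_complement (ILAT l G) T" "card T = 3" "\<not> has_true_twins (ILAT l G)"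
    using FZ_eq_card_minus_3D[OF pair_graph_ILAT pverts_ILAT_nonempty eq] assms by metis
  then show False
    using has_true_twins_if_stalled_triple_ILAT1_4[OF pair_graph_ILAT pverts_ILAT_nonempty, of G m T]
      assms l by simp
qed

end
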